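(* Every rapid winning set $S \subseteq \mathbb{R}$ has full Hausdorff dimension, i.e. $\dim_H(S) = 1$.
   Context: The $(\alpha,\beta)$-rapid game, for fixed $0<\alpha,\beta<1$ and a target set $S\subseteq\mathbb{R}$, is played on $\mathbb{R}$ by two players, Alice and Bob, as follows. All balls $B(x,\rho)$ are closed balls (intervals) in $\mathbb{R}$ with centre $x$ and radius $\rho>0$. - At stage $0$, Bob chooses a ball $B_0=B(x_0,\rho_0)$ of any radius $\rho_0>0$, together with a parameter $\alpha_0\in(0,\alpha]$. - At stage $n\ge 0$, after Bob has chosen $B_n=B(x_n,\rho_n)$ and $\alpha_n\in(0,\alpha]$, Alice chooses a ball $A_n=B(y_n,\alpha_n\rho_n)\subseteq B_n$. - At stage $n+1$, Bob chooses a ball $B_{n+1}=B(x_{n+1},\rho_{n+1})\subseteq A_n$ with $\rho_{n+1}=\beta\alpha_n\rho_n$, together with a parameter $\alpha_{n+1}\in(0,\alpha]$. The outcome $x_\infty$ is the unique point of $\bigcap_n B_n$. If $\inf_n\alpha_n>0$, Alice wins by default. Otherwise, Alice wins if and only if $x_\infty\in S$. The set $S$ is $(\alpha,\beta)$-rapid winning if Alice has a strategy with which she wins regardless of how Bob plays. It is $\alpha$-rapid winning if it is $(\alpha,\beta)$-rapid winning for all $\beta\in(0,1)$. It is rapid winning if it is $\alpha$-rapid winning for some $\alpha\in(0,1)$. *)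

theory Defs
  imports "HOL-Analysis.Analysis"
begin

section \<open>Hausdorff measure and dimension\<close>

(* The value diam(U)^s, with the convention 0^0 = 1 for nonempty U (so that the 0-dimensional
   measure counts points) and value 0 for the empty set.  The case s = 0 is separate because
   0 powr 0 = 0. *)
definition diam_pow :: "real \<Rightarrow> 'a::metric_space set \<Rightarrow> real" where
  "diam_pow s U = (if U = {} then 0 else if s = 0 then 1 else diameter U powr s)"

(* Boundedness is required explicitly because diameter is unspecified on unbounded sets.
   Finite covers are included: the remaining sets may be empty. *)
definition delta_covers :: "real \<Rightarrow> 'a::metric_space set \<Rightarrow> (nat \<Rightarrow> 'a set) set" where
  "delta_covers \<delta> A =
     {U. A \<subseteq> (\<Union>i. U i) \<and> (\<forall>i. bounded (U i) \<and> diameter (U i) \<le> \<delta>)}"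

definition hausdorff_premeasure :: "real \<Rightarrow> real \<Rightarrow> 'a::metric_space set \<Rightarrow> ennreal" where
  "hausdorff_premeasure s \<delta> A =
     (INF U\<in>delta_covers \<delta> A. \<Sum>i. ennreal (diam_pow s (U i)))"

definition hausdorff_outer_measure :: "real \<Rightarrow> 'a::metric_space set \<Rightarrow> ennreal" where
  "hausdorff_outer_measure s A = (SUP \<delta>\<in>{0<..}. hausdorff_premeasure s \<delta> A)"

definition hausdorff_dim :: "'a::metric_space set \<Rightarrow> ennreal" where
  "hausdorff_dim A = (INF s\<in>{s. 0 \<le> s \<and> hausdorff_outer_measure s A = 0}. ennreal s)"

section \<open>The rapid game\<close>

(* Throughout, x n and \<rho> n are the centre and radius of Bob's n-th ball, a n is the parameter
   he announces with it, and y n is the centre of Alice's n-th ball, whose radius is forced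
   to be a n * \<rho> n. *)

definition bob_legal ::
    "real \<Rightarrow> real \<Rightarrow> (nat \<Rightarrow> real) \<Rightarrow> (nat \<Rightarrow> real) \<Rightarrow> (nat \<Rightarrow> real) \<Rightarrow> (nat \<Rightarrow> real) \<Rightarrow> bool" where
  "bob_legal \<alpha> \<beta> x \<rho> a y \<longleftrightarrow>
     0 < \<rho> 0 \<and> (\<forall>n. a n \<in> {0<..\<alpha>}) \<and>
     (\<forall>n. \<rho> (Suc n) = \<beta> * a n * \<rho> n \<and>
          cball (x (Suc n)) (\<rho> (Suc n)) \<subseteq> cball (y n) (a n * \<rho> n))"

definition alice_legal ::
    "(nat \<Rightarrow> real) \<Rightarrow> (nat \<Rightarrow> real) \<Rightarrow> (nat \<Rightarrow> real) \<Rightarrow> (nat \<Rightarrow> real) \<Rightarrow> bool" where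
  "alice_legal x \<rho> a y \<longleftrightarrow> (\<forall>n. cball (y n) (a n * \<rho> n) \<subseteq> cball (x n) (\<rho> n))"

definition game_outcome :: "(nat \<Rightarrow> real) \<Rightarrow> (nat \<Rightarrow> real) \<Rightarrow> real" where
  "game_outcome x \<rho> = (THE p. p \<in> (\<Inter>n. cball (x n) (\<rho> n)))"

lemma game_outcome_well_defined:
  assumes "0 < \<alpha>" "\<alpha> < 1" "0 < \<beta>" "\<beta> < 1" and B: "bob_legal \<alpha> \<beta> x \<rho> a y" and A: "alice_legal x \<rho> a y"
  shows "\<exists>!p. p \<in> (\<Inter>n. cball (x n) (\<rho> n))"
proof -
  have a: "0 < a n" "a n \<le> \<alpha>" and Suc: "\<rho> (Suc n) = \<beta> * a n * \<rho> n" for n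
    using B by (auto simp: bob_legal_def)
  have pos: "0 < \<rho> n" for n
    by (induction n) (use B a Suc assms in \<open>auto simp: bob_legal_def\<close>)
  have bound: "\<rho> n \<le> \<beta> ^ n * \<rho> 0" for n
  proof (induction n)
    case (Suc n)
    have "a n * \<rho> n \<le> 1 * \<rho> n"
      using a[of n] pos[of n] assms by (intro mult_right_mono) auto
    hence "\<beta> * (a n * \<rho> n) \<le> \<beta> * (\<beta> ^ n * \<rho> 0)"
      using Suc assms by (intro mult_left_mono) auto
    thus ?case using \<open>\<rho> (Suc n) = \<beta> * a n * \<rho> n\<close> by (simp add: mult.assoc)
  qed simp
  have "(\<lambda>n. \<beta> ^ n * \<rho> 0) \<longlonglongrightarrow> 0"
    using tendsto_mult_left_zero[OF LIMSEQ_realpow_zero[of \<beta>]] assms by simp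
  hence "\<rho> \<longlonglongrightarrow> 0"
    by (rule tendsto_sandwich[OF _ _ tendsto_const, rotated 2])
       (use pos bound in \<open>auto intro!: always_eventually simp: less_imp_le\<close>)
  hence small: "\<exists>n. \<rho> n < e" if "0 < e" for e
    using order_tendstoD(2)[OF _ that] by (metis eventually_sequentially order_refl)
  have "\<exists>p. (\<Inter>n. cball (x n) (\<rho> n)) = {p}"
  proof -
    have step: "cball (x (Suc n)) (\<rho> (Suc n)) \<subseteq> cball (x n) (\<rho> n)" for n
      using A B unfolding alice_legal_def bob_legal_def by blast
    have nested: "cball (x n) (\<rho> n) \<subseteq> cball (x m) (\<rho> m)" if "m \<le> n" for m n
      using lift_Suc_antimono_le[of "\<lambda>n. cball (x n) (\<rho> n)", OF step that] .
    have ex: "\<exists>n. \<forall>u\<in>cball (x n) (\<rho> n). \<forall>v\<in>cball (x n) (\<rho> n). dist u v < e" if "0 < e" for e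
    proof -
      obtain n where n: "\<rho> n < e / 2" using small[of "e / 2"] \<open>0 < e\<close> by auto
      show ?thesis
      proof (intro exI ballI)
        fix u v assume "u \<in> cball (x n) (\<rho> n)" "v \<in> cball (x n) (\<rho> n)"
        thus "dist u v < e" using n dist_triangle3[of u v "x n"] by auto
      qed
    qed
    show ?thesis
      by (rule decreasing_closed_nest_sing[of "\<lambda>n. cball (x n) (\<rho> n)"])
         (use nested ex in \<open>auto simp: not_less less_imp_le[OF pos]\<close>)
  qed
  then obtain p where "(\<Inter>n. cball (x n) (\<rho> n)) = {p}" ..
  thus ?thesis by (simp only: singleton_iff) simp
qed

(* Alice's centre y n, when she follows the strategy \<sigma>, is a function of all moves Bob has made
   up to and including stage n.  Her own earlier moves are determined by \<sigma> and that data. *)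
definition alice_response ::
    "((real \<times> real \<times> real) list \<Rightarrow> real) \<Rightarrow> (nat \<Rightarrow> real) \<Rightarrow> (nat \<Rightarrow> real) \<Rightarrow> (nat \<Rightarrow> real) \<Rightarrow> nat \<Rightarrow> real" where
  "alice_response \<sigma> x \<rho> a n = \<sigma> (map (\<lambda>i. (x i, \<rho> i, a i)) [0..<Suc n])"

(* The strategy has to produce legal moves also in plays that Alice wins by default.  Testing
   this only on infinite plays loses nothing: Bob can extend every finite play. *)
definition rapid_winning_param :: "real \<Rightarrow> real \<Rightarrow> real set \<Rightarrow> bool" where
  "rapid_winning_param \<alpha> \<beta> S \<longleftrightarrow>
     (\<exists>\<sigma>. \<forall>x \<rho> a. bob_legal \<alpha> \<beta> x \<rho> a (alice_response \<sigma> x \<rho> a) \<longrightarrow>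
        alice_legal x \<rho> a (alice_response \<sigma> x \<rho> a) \<and>
        ((INF n. a n) > 0 \<or> game_outcome x \<rho> \<in> S))"

definition alpha_rapid_winning :: "real \<Rightarrow> real set \<Rightarrow> bool" where
  "alpha_rapid_winning \<alpha> S \<longleftrightarrow> (\<forall>\<beta>\<in>{0<..<1}. rapid_winning_param \<alpha> \<beta> S)"

definition rapid_winning :: "real set \<Rightarrow> bool" where
  "rapid_winning S \<longleftrightarrow> (\<exists>\<alpha>\<in>{0<..<1}. alpha_rapid_winning \<alpha> S)"

end

(* Bob restricts himself to N evenly spaced, well separated balls inside Alice's ball, with
   \<beta> = 1 / (4 N), and announces \<alpha> except for factors that tend to 0 along a sparse sequence of
   stages.  Then Alice cannot win by default, so every outcome lies in S.  Letting Bob play the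
   base-N digits of t gives a map p from [0,1) into S, and since the exceptional factors are
   negligible, |t - u| \<le> C |p t - p u|^s for any s < 1 once N is large.  A cover of S by sets U_i
   therefore induces a cover of [0,1) by intervals of length at most 2 C (diam U_i)^s, and
   Lebesgue measure bounds the sum of (diam U_i)^s from below; no mass distribution on S is
   needed. *)

theory Submission
  imports Defs "HOL-Library.Discrete_Functions"
begin

section \<open>Hausdorff measure: lower bound from a parametrization, upper bound on the
  line\<close>

text \<open>The inverse of \<open>p\<close> is Hoelder of exponent \<open>s\<close>, so a cheap
  cover of \<open>A\<close> would pull back to a cover of [0,1) of total length below 1.\<close>

lemma hausdorff_outer_measure_nonzero:
  fixes A :: "'a::metric_space set" and p :: "real \<Rightarrow> 'a"
  assumes "0 \<le> s" "0 < C"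
    and pA: "\<And>t. t \<in> {0..<1} \<Longrightarrow> p t \<in> A"
    and holder: "\<And>t u. t \<in> {0..<1} \<Longrightarrow> u \<in> {0..<1} \<Longrightarrow> \<bar>t - u\<bar> \<le> C * dist (p t) (p u) powr s"
  shows "hausdorff_outer_measure s A \<noteq> 0"
proof
  assume "hausdorff_outer_measure s A = 0"
  hence "hausdorff_premeasure s 1 A = 0"
    unfolding hausdorff_outer_measure_def
    by (metis SUP_upper greaterThan_iff le_zero_eq zero_less_one)
  \<comment> \<open>Each \<open>U i\<close> will account for an interval of length
    \<open>2 * C * diam_pow s (U i)\<close>; this threshold keeps their total below 1.\<close>
  also have "(0::ennreal) < ennreal (1 / (2 * C))"
    using \<open>0 < C\<close> by simp
  finally obtain U where U: "U \<in> delta_covers 1 A"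
    and sum_U: "(\<Sum>i. ennreal (diam_pow s (U i))) < ennreal (1 / (2 * C))"
    unfolding hausdorff_premeasure_def INF_less_iff by blast
  define I where "I i = p -` U i \<inter> {0..<1}" for i
  \<comment> \<open>\<open>p\<close> is arbitrary, so \<open>I i\<close> need not be measurable; an
    interval centred at one of its points replaces it.\<close>
  have "\<exists>c. I i \<subseteq> {c - C * diam_pow s (U i)..c + C * diam_pow s (U i)}" for i
  proof (cases "I i = {}")
    case False
    then obtain c where c: "c \<in> I i" by blast
    have "\<bar>t - c\<bar> \<le> C * diam_pow s (U i)" if t: "t \<in> I i" for t
    proof -
      have "p t \<in> U i" "p c \<in> U i" using t c by (auto simp: I_def)
      moreover have "bounded (U i)" using U by (auto simp: delta_covers_def)
      ultimately have "dist (p t) (p c) \<le> diameter (U i)"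
        by (intro diameter_bounded_bound)
      hence "dist (p t) (p c) powr s \<le> diam_pow s (U i)"
        using \<open>p t \<in> U i\<close> \<open>0 \<le> s\<close> by (auto simp: diam_pow_def powr_mono2)
      moreover have "\<bar>t - c\<bar> \<le> C * dist (p t) (p c) powr s"
        using t c by (intro holder) (auto simp: I_def)
      ultimately show ?thesis
        using \<open>0 < C\<close> by (meson dual_order.trans mult_left_mono less_imp_le)
    qed
    thus ?thesis by (intro exI[of _ c]) (force simp: abs_le_iff)
  qed auto
  then obtain c where c: "\<And>i. I i \<subseteq> {c i - C * diam_pow s (U i)..c i + C * diam_pow s (U i)}"
    by metis
  have nonneg: "0 \<le> diam_pow s V" for V :: "'a set"
    by (simp add: diam_pow_def)
  have "{0..<1} \<subseteq> (\<Union>i. I i)"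
    using U pA by (fastforce simp: delta_covers_def I_def)
  hence "{0..<1::real} \<subseteq> (\<Union>i. {c i - C * diam_pow s (U i)..c i + C * diam_pow s (U i)})"
    using c by blast
  hence "emeasure lborel {0..<1::real} \<le>
      emeasure lborel (\<Union>i. {c i - C * diam_pow s (U i)..c i + C * diam_pow s (U i)})"
    by (intro emeasure_mono) auto
  also have "\<dots> \<le> (\<Sum>i. emeasure lborel {c i - C * diam_pow s (U i)..c i + C * diam_pow s (U i)})"
    by (intro emeasure_subadditive_countably) auto
  also have "\<dots> = (\<Sum>i. ennreal (2 * C) * ennreal (diam_pow s (U i)))"
    using \<open>0 < C\<close> nonneg by (intro suminf_cong) (simp add: ennreal_mult[symmetric])
  also have "\<dots> = ennreal (2 * C) * (\<Sum>i. ennreal (diam_pow s (U i)))"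
    by simp
  also have "\<dots> < ennreal (2 * C) * ennreal (1 / (2 * C))"
    using sum_U \<open>0 < C\<close> by (intro ennreal_mult_strict_left_mono) auto
  also have "\<dots> = 1"
    using \<open>0 < C\<close> by (simp flip: ennreal_mult)
  finally show False by simp
qed

(* Cover the line by intervals with lengths c / (k + 1), which have infinite total length while
   the sum of their s-th powers is small. *)
lemma hausdorff_outer_measure_real_eq_0:
  fixes A :: "real set"
  assumes "1 < s"
  shows "hausdorff_outer_measure s A = 0"
proof -
  define K where "K = (\<Sum>i. real (Suc i) powr - s)"
  have summ: "summable (\<lambda>i. real (Suc i) powr - s)"
    using assms by (subst summable_Suc_iff) (simp add: summable_real_powr_iff)
  have le_eps: "hausdorff_premeasure s \<delta> A \<le> 0 + ennreal e" if "0 < \<delta>" "0 < e" for \<delta> e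
  proof -
    \<comment> \<open>This limit is 0, as \<open>0 powr s\<close> is 0. It supplies a scale
      \<open>c\<close> with total cost below \<open>e\<close>; \<open>c < \<delta> / 2\<close> keeps
      the diameters below \<delta>.\<close>
    have "((\<lambda>c. (2 * c) powr s * K) \<longlongrightarrow> (2 * 0) powr s * K) (at_right 0)"
      using assms eventually_at_right_less[of "0::real"]
      by (intro tendsto_intros tendsto_powr') (auto elim: eventually_mono)
    hence "\<forall>\<^sub>F c in at_right 0. (2 * c) powr s * K < e"
      using \<open>0 < e\<close> assms by (intro order_tendstoD(2)) auto
    moreover have "\<forall>\<^sub>F c in at_right 0. 0 < c \<and> c < \<delta> / 2"
      using \<open>0 < \<delta>\<close> by (intro eventually_at_rightI[of 0 "\<delta> / 2"]) auto
    ultimately have "\<forall>\<^sub>F c in at_right 0. (2 * c) powr s * K < e \<and> 0 < c \<and> c < \<delta> / 2"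
      by eventually_elim simp
    then obtain c where c: "0 < c" "(2 * c) powr s * K < e" "2 * c < \<delta>"
      using eventually_happens[of _ "at_right (0::real)"] by (auto simp: field_simps)
    \<comment> \<open>Even indices tile the right half-line, odd ones mirror them. Each length c /
      (k + 1) occurs twice, whence the factor 2 in \<open>diam_le\<close>.\<close>
    define U where "U i = (if even i then {c * harm (i div 2)..c * harm (Suc (i div 2))}
      else {- (c * harm (Suc (i div 2)))..- (c * harm (i div 2))})" for i
    have diam_eq: "diameter (U i) = c / real (Suc (i div 2))" for i
    proof -
      have "c * harm (Suc (i div 2)) = c * harm (i div 2) + c / real (Suc (i div 2))"
        by (simp add: harm_Suc distrib_left divide_inverse)
      moreover have "0 \<le> c / real (Suc (i div 2))"
        using c(1) by simp
      ultimately show ?thesis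
        by (simp add: U_def)
    qed
    have diam_le: "diameter (U i) \<le> 2 * c / real (Suc i)" for i
    proof -
      have "Suc i \<le> 2 * Suc (i div 2)"
        by presburger
      hence "real (Suc i) \<le> 2 * real (Suc (i div 2))"
        by (metis of_nat_le_iff of_nat_mult of_nat_numeral)
      hence "c * real (Suc i) \<le> c * (2 * real (Suc (i div 2)))"
        using c(1) by (intro mult_left_mono) auto
      thus ?thesis
        unfolding diam_eq by (simp add: divide_simps mult_ac)
    qed
    have "\<exists>i. x \<in> U i" for x
    proof -
      \<comment> \<open>The harmonic series diverges and \<open>harm 0\<close> is 0, so the first
        partial sum above \<open>\<bar>x\<bar> / c\<close> has a predecessor not above it.\<close>
      have "\<exists>k. \<bar>x\<bar> / c < harm k"
        using eventually_happens'[OF _ filterlim_at_top_dense[THEN iffD1, OF harm_at_top, rule_format]]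
        by auto
      moreover have "\<not> \<bar>x\<bar> / c < harm 0"
        using c(1) by (simp add: harm_def not_less)
      ultimately obtain k where "\<not> \<bar>x\<bar> / c < harm k" "\<bar>x\<bar> / c < harm (Suc k)"
        using ex_least_nat_less[of "\<lambda>k. \<bar>x\<bar> / c < harm k"] by blast
      hence "\<bar>x\<bar> \<in> {c * harm k..c * harm (Suc k)}"
        using c(1) by (auto simp: field_simps)
      hence "x \<in> U (if 0 \<le> x then 2 * k else 2 * k + 1)"
        by (auto simp: U_def split: if_splits)
      thus ?thesis ..
    qed
    moreover have "bounded (U i)" for i
      by (simp add: U_def)
    moreover have "diameter (U i) \<le> \<delta>" for i
    proof -
      have "2 * c / real (Suc i) \<le> 2 * c / 1"
        using c(1) by (intro divide_left_mono) auto
      thus ?thesis using diam_le[of i] c(3) by simp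
    qed
    ultimately have "U \<in> delta_covers \<delta> A"
      by (auto simp: delta_covers_def)
    hence "hausdorff_premeasure s \<delta> A \<le> (\<Sum>i. ennreal (diam_pow s (U i)))"
      unfolding hausdorff_premeasure_def by (rule INF_lower)
    also have "\<dots> \<le> (\<Sum>i. ennreal ((2 * c) powr s * real (Suc i) powr - s))"
    proof (intro suminf_le summableI ennreal_leI)
      fix i
      have "diam_pow s (U i) \<le> (2 * c / real (Suc i)) powr s"
        using assms diam_le[of i] c(1) by (auto simp: diam_pow_def diam_eq intro!: powr_mono2)
      thus "diam_pow s (U i) \<le> (2 * c) powr s * real (Suc i) powr - s"
        using c(1) by (simp add: powr_divide powr_minus_divide)
    qed
    also have "\<dots> = ennreal ((2 * c) powr s * K)"
      unfolding K_def suminf_mult[OF summ, symmetric]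
      by (rule suminf_ennreal2[OF _ summable_mult[OF summ]]) simp
    also have "\<dots> \<le> ennreal e"
      using c by (simp add: ennreal_leI)
    finally show ?thesis by simp
  qed
  have "hausdorff_premeasure s \<delta> A \<le> 0" if "0 < \<delta>" for \<delta>
    using le_eps[OF that] by (rule ennreal_le_epsilon)
  thus ?thesis
    by (simp add: hausdorff_outer_measure_def)
qed

lemma hausdorff_dim_real_le_1:
  fixes A :: "real set"
  shows "hausdorff_dim A \<le> 1"
proof (rule ennreal_le_epsilon)
  fix e :: real assume "0 < e"
  hence "hausdorff_dim A \<le> ennreal (1 + e)"
    unfolding hausdorff_dim_def
    by (intro INF_lower) (auto simp: hausdorff_outer_measure_real_eq_0)
  thus "hausdorff_dim A \<le> 1 + ennreal e"
    using \<open>0 < e\<close> by (subst (asm) ennreal_plus) auto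
qed

section \<open>Bob's plays driven by digit sequences\<close>

(* The play in which Bob's digit d n \<in> {0..<N} selects his ball inside Alice's n-th ball.  The ball
   number d has its centre 4 d radii to the right of Alice's centre, so only the right half of
   her ball is used and distinct choices leave a gap of two radii. *)
primrec bob_history ::
    "((real \<times> real \<times> real) list \<Rightarrow> real) \<Rightarrow> (nat \<Rightarrow> real) \<Rightarrow> (nat \<Rightarrow> real) \<Rightarrow> (nat \<Rightarrow> int) \<Rightarrow> nat
      \<Rightarrow> (real \<times> real \<times> real) list" where
  "bob_history \<sigma> \<rho> a d 0 = [(0, \<rho> 0, a 0)]"
| "bob_history \<sigma> \<rho> a d (Suc n) = bob_history \<sigma> \<rho> a d n @
     [(\<sigma> (bob_history \<sigma> \<rho> a d n) + 4 * \<rho> (Suc n) * d n, \<rho> (Suc n), a (Suc n))]"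

text \<open>A strategy reads all earlier moves, so the recursion runs on histories and the centre is
  read off afterwards.\<close>

definition bob_centre ::
    "((real \<times> real \<times> real) list \<Rightarrow> real) \<Rightarrow> (nat \<Rightarrow> real) \<Rightarrow> (nat \<Rightarrow> real) \<Rightarrow> (nat \<Rightarrow> int) \<Rightarrow> nat \<Rightarrow> real" where
  "bob_centre \<sigma> \<rho> a d n = fst (last (bob_history \<sigma> \<rho> a d n))"

text \<open>Matches the recursively built list with the one that \<open>alice_response\<close>
  passes to \<sigma>.\<close>

lemma bob_history_eq:
  "bob_history \<sigma> \<rho> a d n = map (\<lambda>i. (bob_centre \<sigma> \<rho> a d i, \<rho> i, a i)) [0..<Suc n]"
proof (induction n)
  case (Suc n)
  have "bob_history \<sigma> \<rho> a d (Suc n) =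
      bob_history \<sigma> \<rho> a d n @ [(bob_centre \<sigma> \<rho> a d (Suc n), \<rho> (Suc n), a (Suc n))]"
    by (simp add: bob_centre_def)
  thus ?case
    by (simp only: Suc.IH upt_Suc_append[of 0 "Suc n"] map_append list.map zero_le)
qed (simp add: bob_centre_def)

lemma bob_history_cong:
  "(\<And>i. i < n \<Longrightarrow> d i = d' i) \<Longrightarrow> bob_history \<sigma> \<rho> a d n = bob_history \<sigma> \<rho> a d' n"
  by (induction n) auto

lemma alice_response_bob_centre:
  "alice_response \<sigma> (bob_centre \<sigma> \<rho> a d) \<rho> a n = \<sigma> (bob_history \<sigma> \<rho> a d n)"
  by (simp only: alice_response_def bob_history_eq)

lemma bob_centre_Suc:
  "bob_centre \<sigma> \<rho> a d (Suc n) = \<sigma> (bob_history \<sigma> \<rho> a d n) + 4 * \<rho> (Suc n) * d n"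
  by (simp add: bob_centre_def)

text \<open>Alice's radius is 4 N of Bob's next radii, and his farthest choice reaches only 4 (N -
  1) + 1 of them from her centre.\<close>

lemma bob_centre_legal:
  assumes "0 < N" "0 < \<rho> 0" and a: "\<And>n. a n \<in> {0<..\<alpha>}"
    and \<rho>: "\<And>n. \<rho> (Suc n) = 1 / (4 * real N) * a n * \<rho> n"
    and d: "\<And>n. d n \<in> {0..<int N}"
  shows "bob_legal \<alpha> (1 / (4 * real N)) (bob_centre \<sigma> \<rho> a d) \<rho> a
           (alice_response \<sigma> (bob_centre \<sigma> \<rho> a d) \<rho> a)"
proof -
  have pos: "0 < \<rho> n" for n
    by (induction n) (use assms in auto)
  have "cball (bob_centre \<sigma> \<rho> a d (Suc n)) (\<rho> (Suc n)) \<subseteq> cball (\<sigma> (bob_history \<sigma> \<rho> a d n)) (a n * \<rho> n)" for n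
  proof -
    have "real_of_int (d n) \<le> real N - 1" "0 \<le> real_of_int (d n)"
      using d[of n] by auto
    hence "4 * \<rho> (Suc n) * d n \<le> 4 * \<rho> (Suc n) * (real N - 1)"
      using pos[of "Suc n"] by (intro mult_left_mono) auto
    moreover have "a n * \<rho> n = 4 * \<rho> (Suc n) * real N"
      using \<rho>[of n] \<open>0 < N\<close> by simp
    moreover have "dist (bob_centre \<sigma> \<rho> a d (Suc n)) (\<sigma> (bob_history \<sigma> \<rho> a d n)) = 4 * \<rho> (Suc n) * d n"
      using pos[of "Suc n"] \<open>0 \<le> real_of_int (d n)\<close>
      by (simp add: bob_centre_Suc dist_real_def)
    ultimately have "dist (bob_centre \<sigma> \<rho> a d (Suc n)) (\<sigma> (bob_history \<sigma> \<rho> a d n)) + \<rho> (Suc n) \<le> a n * \<rho> n"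
      using pos[of "Suc n"] by (simp add: right_diff_distrib)
    thus ?thesis
      by (simp add: cball_subset_cball_iff)
  qed
  thus ?thesis
    using assms by (auto simp: bob_legal_def alice_response_bob_centre)
qed

text \<open>Up to stage \<open>n\<close> the histories coincide, so Alice's centre is the same.
  Bob's next centres are then at least four radii apart, and the two points use up at most two of
  these.\<close>

lemma bob_outcomes_separated:
  fixes d d' :: "nat \<Rightarrow> int"
  assumes agree: "\<And>i. i < n \<Longrightarrow> d i = d' i" and "d n \<noteq> d' n" and "0 \<le> \<rho> (Suc n)"
    and p: "p \<in> cball (bob_centre \<sigma> \<rho> a d (Suc n)) (\<rho> (Suc n))"
    and q: "q \<in> cball (bob_centre \<sigma> \<rho> a d' (Suc n)) (\<rho> (Suc n))"
  shows "\<rho> (Suc n) \<le> dist p q"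
proof -
  have "1 \<le> \<bar>real_of_int (d n) - real_of_int (d' n)\<bar>"
    using \<open>d n \<noteq> d' n\<close> by linarith
  hence "4 * \<rho> (Suc n) * 1 \<le> 4 * \<rho> (Suc n) * \<bar>real_of_int (d n) - real_of_int (d' n)\<bar>"
    using assms(3) by (intro mult_left_mono) auto
  also have "\<dots> = dist (bob_centre \<sigma> \<rho> a d (Suc n)) (bob_centre \<sigma> \<rho> a d' (Suc n))"
    using assms(3) bob_history_cong[of n d d' \<sigma> \<rho> a, OF agree]
    by (simp add: bob_centre_Suc dist_real_def abs_mult flip: right_diff_distrib)
  also have "\<dots> \<le> \<rho> (Suc n) + dist p q + \<rho> (Suc n)"
    using p q dist_triangle[of "bob_centre \<sigma> \<rho> a d (Suc n)" "bob_centre \<sigma> \<rho> a d' (Suc n)" p]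
      dist_triangle2[of p "bob_centre \<sigma> \<rho> a d' (Suc n)" q]
    by (simp add: dist_commute)
  finally show ?thesis using assms(3) by linarith
qed

section \<open>Digits in base N\<close>

text \<open>Counting starts at 0: this digit has weight N^-(n+1).\<close>

definition digit :: "nat \<Rightarrow> real \<Rightarrow> nat \<Rightarrow> int" where
  "digit N t n = \<lfloor>real N ^ Suc n * t\<rfloor> mod int N"

lemma digit_range: "0 < N \<Longrightarrow> digit N t n \<in> {0..<int N}"
  by (simp add: digit_def)

text \<open>Points sharing their first \<open>n\<close> digits have N^n-multiples with the same
  floor, hence less than 1 apart; distinct points cannot do so for all \<open>n\<close>.\<close>

lemma first_differing_digit:
  assumes "2 \<le> N" "t \<in> {0..<1}" "u \<in> {0..<1}" "t \<noteq> u"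
  obtains n where "\<And>i. i < n \<Longrightarrow> digit N t i = digit N u i" "digit N t n \<noteq> digit N u n"
    "\<bar>t - u\<bar> \<le> 1 / real N ^ n"
proof -
  \<comment> \<open>The integer spelled by the first \<open>n\<close> digits of
    \<open>v\<close>.\<close>
  define F where "F v n = \<lfloor>real N ^ n * v\<rfloor>" for v n
  have F0: "F t 0 = F u 0" using assms floor_unique[of 0 t] floor_unique[of 0 u] by (simp add: F_def)
  have F_Suc: "F v (Suc n) = int N * F v n + digit N v n" for v n
  proof -
    have "F v n = F v (Suc n) div int N"
      using assms(1) floor_divide_real_eq_div[of "int N" "real N ^ Suc n * v"]
      by (simp add: F_def mult.assoc)
    thus ?thesis by (simp add: digit_def F_def)
  qed
  have close: "\<bar>t - u\<bar> < 1 / real N ^ n" if "F t n = F u n" for n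
  proof -
    have "\<bar>real N ^ n * t - real N ^ n * u\<bar> < 1"
      using that unfolding F_def by linarith
    thus ?thesis using assms(1)
      by (simp add: pos_less_divide_eq abs_mult mult.commute flip: left_diff_distrib right_diff_distrib)
  qed
  have "\<exists>n. F t n \<noteq> F u n"
  proof (rule ccontr)
    assume *: "\<nexists>n. F t n \<noteq> F u n"
    obtain n where "1 / \<bar>t - u\<bar> < real N ^ n"
      using assms(1) real_arch_pow[of "real N" "1 / \<bar>t - u\<bar>"] by auto
    moreover have "\<bar>t - u\<bar> < 1 / real N ^ n" using * close by blast
    ultimately show False using assms by (simp add: field_simps)
  qed
  \<comment> \<open>\<open>m\<close> is positive because both integers start at 0. Digit
    \<open>n\<close> first enters in \<open>F v (Suc n)\<close>, so the sought position is
    \<open>m - 1\<close>.\<close>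
  define m where "m = (LEAST n. F t n \<noteq> F u n)"
  have m: "F t m \<noteq> F u m" unfolding m_def by (rule LeastI_ex) fact
  have less: "F t i = F u i" if "i < m" for i
    using not_less_Least[of i "\<lambda>n. F t n \<noteq> F u n"] that by (auto simp: m_def)
  obtain n where n: "m = Suc n" using m F0 by (cases m) auto
  show ?thesis
  proof (rule that[of n])
    show "digit N t i = digit N u i" if "i < n" for i
      using less[of "Suc i"] less[of i] that by (simp add: n F_Suc)
    show "digit N t n \<noteq> digit N u n"
      using m less[of n] by (auto simp: n F_Suc)
    show "\<bar>t - u\<bar> \<le> 1 / real N ^ n"
      using close[OF less] by (simp add: n less_imp_le)
  qed
qed

section \<open>Choice of the parameters\<close>

text \<open>The quantity is N^(1-s) (\<alpha>/4)^s, unbounded in N since s < 1. The bound 2 leaves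
  room for the radii lost to Bob's small parameters.\<close>

lemma exists_large_branching:
  fixes \<alpha> s :: real
  assumes "0 < \<alpha>" "0 \<le> s" "s < 1"
  obtains N :: nat where "2 \<le> N" "2 \<le> real N * (\<alpha> / (4 * real N)) powr s"
proof -
  obtain N :: nat where N: "2 \<le> N" "(2 / (\<alpha> / 4) powr s) powr (1 / (1 - s)) \<le> real N"
    by (metis of_nat_le_iff max.bounded_iff of_nat_numeral real_arch_simple)
  have "2 / (\<alpha> / 4) powr s = ((2 / (\<alpha> / 4) powr s) powr (1 / (1 - s))) powr (1 - s)"
    using assms by (simp add: powr_powr)
  also have "\<dots> \<le> real N powr (1 - s)"
    using N assms by (intro powr_mono2) auto
  also have "\<dots> = real N / real N powr s"
    using N by (simp add: powr_diff)
  finally have "2 \<le> real N / real N powr s * (\<alpha> / 4) powr s"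
    using assms by (simp add: field_simps)
  also have "\<dots> = real N * (\<alpha> / 4 / real N) powr s"
    using assms by (subst powr_divide[of "\<alpha> / 4" "real N"]) auto
  finally show ?thesis using that[OF N(1)] by simp
qed

text \<open>The argument k^2 + 2k is one less than (k + 1)^2, so the root jumps from k to k +
  1.\<close>

lemma floor_sqrt_square_gap:
  "(floor_sqrt (Suc (k\<^sup>2 + 2 * k)))\<^sup>2 - (floor_sqrt (k\<^sup>2 + 2 * k))\<^sup>2 \<ge> k"
proof -
  have "floor_sqrt (k\<^sup>2 + 2 * k) < Suc k"
    using floor_sqrt_power2_le[of "k\<^sup>2 + 2 * k"]
    by (intro power2_less_imp_less[of _ "Suc k"]) (auto simp: power2_eq_square algebra_simps intro: le_less_trans)
  hence "(floor_sqrt (k\<^sup>2 + 2 * k))\<^sup>2 \<le> k\<^sup>2"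
    by (intro power_mono) auto
  moreover have "Suc (k\<^sup>2 + 2 * k) = (Suc k)\<^sup>2"
    by (simp add: power2_eq_square)
  hence "floor_sqrt (Suc (k\<^sup>2 + 2 * k)) = Suc k"
    by (simp only: floor_sqrt_inverse_power2)
  ultimately show ?thesis by (simp add: power2_eq_square)
qed

section \<open>The Hoelder estimate and the dimension\<close>

lemma rapid_winning_hausdorff_outer_measure_nonzero:
  assumes \<alpha>: "0 < \<alpha>" "\<alpha> < 1" and win: "alpha_rapid_winning \<alpha> S" and s: "0 \<le> s" "s < 1"
  shows "hausdorff_outer_measure s S \<noteq> 0"
proof -
  obtain N :: nat where N: "2 \<le> N" "2 \<le> real N * (\<alpha> / (4 * real N)) powr s"
    using exists_large_branching \<alpha>(1) s by blast
  define \<beta> where "\<beta> = 1 / (4 * real N)"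
  have \<beta>: "0 < \<beta>" "\<beta> < 1" using N(1) by (auto simp: \<beta>_def field_simps)
  define g where "g n = (floor_sqrt n)\<^sup>2" for n
  have g_le: "g n \<le> n" for n by (simp add: g_def)
  have g_mono: "g n \<le> g (Suc n)" for n
    by (auto simp: g_def intro!: power_mono mono_floor_sqrt')
  \<comment> \<open>\<open>g n \<le> n\<close> costs at most a factor \<open>2 ^ n\<close> up to stage \<open>n\<close>, which the choice of \<open>N\<close> absorbs, yet
    the jumps of \<open>g\<close> just below perfect squares are unbounded.\<close>
  define \<rho> where "\<rho> n = (\<beta> * \<alpha>) ^ n / 2 ^ g n" for n
  \<comment> \<open>Forced by the recursion for \<rho>: the powers of 2 telescope. The natural
    subtraction is genuine by \<open>g_mono\<close>.\<close>
  define a where "a n = \<alpha> / 2 ^ (g (Suc n) - g n)" for n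
  have \<rho>_pos: "0 < \<rho> n" for n using \<alpha> \<beta> by (simp add: \<rho>_def)
  have \<rho>_Suc: "\<rho> (Suc n) = \<beta> * a n * \<rho> n" for n
    using g_mono[of n] by (simp add: \<rho>_def a_def field_simps flip: power_add)
  have a: "a n \<in> {0<..\<alpha>}" for n
    using \<alpha> by (simp add: a_def field_simps)
  have inf_a: "\<not> (INF n. a n) > 0"
  proof
    assume *: "(INF n. a n) > 0"
    obtain k where "1 / (INF n. a n) < 2 ^ k"
      using real_arch_pow[of 2 "1 / (INF n. a n)"] by auto
    hence "1 / 2 ^ k < (INF n. a n)" using * by (simp add: field_simps)
    \<comment> \<open>The stage just before a perfect square, where \<open>g\<close> jumps by at
      least \<open>k\<close>.\<close>
    also have "(INF n. a n) \<le> a (k\<^sup>2 + 2 * k)"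
      using a by (intro cINF_lower bdd_belowI[of _ 0]) (auto simp: less_imp_le)
    also have "\<dots> \<le> 1 / 2 ^ k"
      unfolding a_def g_def using \<alpha> floor_sqrt_square_gap[of k]
      by (intro frac_le power_increasing) auto
    finally show False by simp
  qed
  obtain \<sigma> where \<sigma>: "\<And>x \<rho> a. bob_legal \<alpha> \<beta> x \<rho> a (alice_response \<sigma> x \<rho> a) \<Longrightarrow>
      alice_legal x \<rho> a (alice_response \<sigma> x \<rho> a) \<and> ((INF n. a n) > 0 \<or> game_outcome x \<rho> \<in> S)"
    using win \<beta> unfolding alpha_rapid_winning_def rapid_winning_param_def
    by (metis greaterThanLessThan_iff)
  define x where "x t = bob_centre \<sigma> \<rho> a (digit N t)" for t
  have bob: "bob_legal \<alpha> \<beta> (x t) \<rho> a (alice_response \<sigma> (x t) \<rho> a)" for t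
    unfolding x_def \<beta>_def
    using N(1) \<rho>_pos a \<rho>_Suc digit_range[of N t] by (intro bob_centre_legal) (auto simp: \<beta>_def)
  have outcome_ball: "game_outcome (x t) \<rho> \<in> cball (x t n) (\<rho> n)" for t n
    using theI'[OF game_outcome_well_defined[OF \<alpha> \<beta> bob]] \<sigma>[OF bob]
    unfolding game_outcome_def by blast
  \<comment> \<open>As s < 1, the loss (2^g)^s is at most 2^(n+1), which the slack 2 in the choice
    of N pays for. The extra factor N comes from comparing \<open>n\<close> digits with the radius
    of stage n + 1; it becomes the Hoelder constant.\<close>
  have rate: "1 / real N ^ n \<le> real N * \<rho> (Suc n) powr s" for n
  proof -
    have "1 \<le> (real N * (\<beta> * \<alpha>) powr s / 2) ^ Suc n"
      using N(2) by (intro one_le_power) (simp add: \<beta>_def mult.commute)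
    also have "\<dots> = real N * real N ^ n * (((\<beta> * \<alpha>) powr s) ^ Suc n / 2 ^ Suc n)"
      by (simp add: power_divide power_mult_distrib)
    also have "((\<beta> * \<alpha>) powr s) ^ Suc n = ((\<beta> * \<alpha>) ^ Suc n) powr s"
      using \<alpha> \<beta> by (simp add: powr_powr mult.commute del: power_Suc flip: powr_realpow)
    also have "((\<beta> * \<alpha>) ^ Suc n) powr s / 2 ^ Suc n \<le> \<rho> (Suc n) powr s"
    proof -
      have "(2 ^ g (Suc n)) powr s \<le> (2 ^ g (Suc n)) powr (1::real)"
        using s by (intro powr_mono) auto
      also have "\<dots> \<le> (2::real) ^ Suc n"
        using g_le[of "Suc n"] by (simp del: power_Suc)
      finally show ?thesis
        unfolding \<rho>_def using \<alpha> \<beta> by (subst powr_divide) (auto intro!: divide_left_mono)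
    qed
    finally show ?thesis
      using N(1) by (simp add: field_simps)
  qed
  show ?thesis
  proof (rule hausdorff_outer_measure_nonzero[of s "real N" "\<lambda>t. game_outcome (x t) \<rho>"])
    show "game_outcome (x t) \<rho> \<in> S" for t
      using \<sigma>[OF bob] inf_a by blast
    fix t u :: real assume tu: "t \<in> {0..<1}" "u \<in> {0..<1}"
    show "\<bar>t - u\<bar> \<le> real N * dist (game_outcome (x t) \<rho>) (game_outcome (x u) \<rho>) powr s"
    proof (cases "t = u")
      case False
      then obtain n where n: "\<And>i. i < n \<Longrightarrow> digit N t i = digit N u i"
        "digit N t n \<noteq> digit N u n" "\<bar>t - u\<bar> \<le> 1 / real N ^ n"
        using first_differing_digit N(1) tu by blast
      have "\<rho> (Suc n) \<le> dist (game_outcome (x t) \<rho>) (game_outcome (x u) \<rho>)"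
        using outcome_ball[of t "Suc n"] outcome_ball[of u "Suc n"] \<rho>_pos[of "Suc n"]
        using n(1,2) unfolding x_def
        by (intro bob_outcomes_separated[where d = "digit N t" and d' = "digit N u" and n = n]) auto
      hence "\<rho> (Suc n) powr s \<le> dist (game_outcome (x t) \<rho>) (game_outcome (x u) \<rho>) powr s"
        using s \<rho>_pos[of "Suc n"] by (intro powr_mono2) auto
      hence "real N * \<rho> (Suc n) powr s \<le> real N * dist (game_outcome (x t) \<rho>) (game_outcome (x u) \<rho>) powr s"
        by (intro mult_left_mono) auto
      with rate[of n] n(3) show ?thesis by linarith
    qed simp
  qed (use s N in auto)
qed

theorem proposition3p3:
  fixes S :: "real set"
  assumes "rapid_winning S"
  shows "hausdorff_dim S = 1"
proof (rule antisym)
  obtain \<alpha> where \<alpha>: "0 < \<alpha>" "\<alpha> < 1" "alpha_rapid_winning \<alpha> S"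
    using assms by (auto simp: rapid_winning_def)
  have "1 \<le> s" if "0 \<le> s" "hausdorff_outer_measure s S = 0" for s
    using rapid_winning_hausdorff_outer_measure_nonzero[OF \<alpha>] that by force
  thus "1 \<le> hausdorff_dim S"
    unfolding hausdorff_dim_def by (auto intro!: INF_greatest)
qed (rule hausdorff_dim_real_le_1)

end
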